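(* Consider an affine IFS with attractor $X$ and invariant measure $\mu$, and suppose the fixed point condition holds for some $k\in\mathbb{N}$ and $\tau\in\mathcal{A}_k$. Then there exist $n_0\in\mathbb{N}$ and a constant $C$ independent of $n$ such that $$\mu(\tau^n(X))=C\,p_\tau^n\quad\text{for all }n\ge n_0,$$ where $\tau^n$ denotes the $n$-fold composition of $\tau$.
   Context: Affine IFS: $R$ real $d\times d$ expansive matrix, $\mathcal{B}=\{b_1,\dots,b_N\}\subset\mathbb{R}^d$, weights $p_{b_i}>0$ summing to $1$, $\tau_{b_i}(x)=R^{-1}(x+b_i)$, attractor $X=\bigcup_i\tau_{b_i}(X)$, invariant measure $\mu=\sum_ip_{b_i}\mu\circ\tau_{b_i}^{-1}$. For a word $I=i_1\cdots i_n\in\{1,\dots,N\}^n$ let $\tau_I=\tau_{b_{i_1}}\circ\cdots\circ\tau_{b_{i_n}}$ and $p_I=p_{b_{i_1}}\cdots p_{b_{i_n}}$. $\mathcal{A}_n$ is the set of distinct maps among $\{\tau_I: I\in\{1,\dots,N\}^n\}$ (words giving the same map are identified), and for $\tau\in\mathcal{A}_n$, $p_\tau=\sum\{p_I:\tau_I=\tau\}$; thus $\mu=\sum_{\tau\in\mathcal{A}_n}p_\tau\mu\circ\tau^{-1}$. For $\tau\in\mathcal{A}_n$, $x_\tau$ denotes its fixed point. Fixed point condition (for $k$ and $\tau\in\mathcal{A}_k$): $x_\tau\notin\tilde\tau(X)$ for every $\tilde\tau\in\mathcal{A}_k$ with $\tilde\tau\ne\tau$. *)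

theory Defs
  imports "HOL-Analysis.Analysis" "HOL-Probability.Probability"
begin

text \<open>Affine IFS in R^d, d = CARD('n). The contraction tau_b(x) = R^{-1}(x + b).\<close>
definition ifs_map :: "real^'n^'n \<Rightarrow> real^'n \<Rightarrow> real^'n \<Rightarrow> real^'n" where
  "ifs_map R b x = matrix_inv R *v (x + b)"

text \<open>Expansive: every complex eigenvalue of R has modulus > 1.\<close>
definition expansive :: "real^'n^'n \<Rightarrow> bool" where
  "expansive R \<longleftrightarrow> (\<forall>lam::complex.
     det (\<chi> i j. complex_of_real (R$i$j) - (if i = j then lam else 0)) = 0 \<longrightarrow> 1 < cmod lam)"

text \<open>Words of length n over the digit set B (a word is a list of digits b_{i_1} ... b_{i_n}).\<close>
definition words :: "'a set \<Rightarrow> nat \<Rightarrow> 'a list set" where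
  "words B n = {w. set w \<subseteq> B \<and> length w = n}"

text \<open>tau_I = tau_{b_{i_1}} o ... o tau_{b_{i_n}}\<close>
definition word_map :: "real^'n^'n \<Rightarrow> (real^'n) list \<Rightarrow> real^'n \<Rightarrow> real^'n" where
  "word_map R w = foldr (\<lambda>b f. ifs_map R b \<circ> f) w id"

text \<open>p_I = p_{b_{i_1}} ... p_{b_{i_n}}\<close>
definition word_weight :: "('a \<Rightarrow> real) \<Rightarrow> 'a list \<Rightarrow> real" where
  "word_weight p w = prod_list (map p w)"

text \<open>A_n: the set of distinct maps tau_I with |I| = n.\<close>
definition maps_level :: "real^'n^'n \<Rightarrow> (real^'n) set \<Rightarrow> nat \<Rightarrow> (real^'n \<Rightarrow> real^'n) set" where
  "maps_level R B n = word_map R ` words B n"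

text \<open>p_tau for tau in A_n: sum of p_I over all words I of length n with tau_I = tau.\<close>
definition map_weight :: "real^'n^'n \<Rightarrow> (real^'n) set \<Rightarrow> (real^'n \<Rightarrow> real) \<Rightarrow> nat
    \<Rightarrow> (real^'n \<Rightarrow> real^'n) \<Rightarrow> real" where
  "map_weight R B p n tau = (\<Sum>w\<in>{w \<in> words B n. word_map R w = tau}. word_weight p w)"

text \<open>Attractor: nonempty compact X with X = union of tau_b(X).\<close>
definition is_attractor :: "real^'n^'n \<Rightarrow> (real^'n) set \<Rightarrow> (real^'n) set \<Rightarrow> bool" where
  "is_attractor R B X \<longleftrightarrow> X \<noteq> {} \<and> compact X \<and> X = (\<Union>b\<in>B. ifs_map R b ` X)"

text \<open>Invariant measure: Borel probability measure with mu = sum_b p_b mu o tau_b^{-1}.\<close>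
definition is_invariant_measure :: "real^'n^'n \<Rightarrow> (real^'n) set \<Rightarrow> (real^'n \<Rightarrow> real)
    \<Rightarrow> (real^'n) measure \<Rightarrow> bool" where
  "is_invariant_measure R B p \<mu> \<longleftrightarrow> prob_space \<mu> \<and> sets \<mu> = sets borel \<and>
     (\<forall>A\<in>sets borel. measure \<mu> A = (\<Sum>b\<in>B. p b * measure \<mu> (ifs_map R b -` A)))"

text \<open>x_tau: the (unique) fixed point of tau.\<close>
definition fixed_point :: "('a \<Rightarrow> 'a) \<Rightarrow> 'a" where
  "fixed_point f = (THE x. f x = x)"

text \<open>Fixed point condition for k and tau in A_k.\<close>
definition fixed_point_condition :: "real^'n^'n \<Rightarrow> (real^'n) set \<Rightarrow> (real^'n) set \<Rightarrow> nat
    \<Rightarrow> (real^'n \<Rightarrow> real^'n) \<Rightarrow> bool" where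
  "fixed_point_condition R B X k tau \<longleftrightarrow>
     (\<forall>tau'\<in>maps_level R B k. tau' \<noteq> tau \<longrightarrow> fixed_point tau \<notin> tau' ` X)"

end

theory Submission
  imports Defs "Jordan_Normal_Form.Spectral_Radius"
begin

text \<open>
  Proof idea.  Write \<open>\<tau> = \<tau>\<^sub>I\<close> with \<open>|I| = k\<close>.  Since \<open>R\<close> is expansive, \<open>R\<^sup>-\<^sup>1\<close> has spectral radius
  below 1, so every word map \<open>\<tau>\<^sub>J\<close> contracts distances by \<open>K \<rho>\<^sup>|\<^sup>J\<^sup>|\<close> with \<open>\<rho> < 1\<close>.  Two
  consequences: (a) the invariant measure \<open>\<mu>\<close> is supported on the attractor \<open>X\<close>, and (b) the
  images \<open>\<tau>\<^sup>n(X)\<close> shrink to the fixed point \<open>x\<^sub>\<tau>\<close>.  By the fixed point condition \<open>x\<^sub>\<tau>\<close> has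
  positive distance from the compact sets \<open>\<sigma>(X)\<close>, \<open>\<sigma> \<in> \<A>\<^sub>k - {\<tau>}\<close>, so for \<open>n \<ge> n\<^sub>0\<close> the set
  \<open>\<tau>\<^sup>n\<^sup>+\<^sup>1(X)\<close> misses all of them.  In the invariance equation
  \<open>\<mu>(A) = \<Sum>\<^sub>\<sigma>\<^sub>\<in>\<^sub>\<A>\<^sub>k p\<^sub>\<sigma> \<mu>(\<sigma>\<^sup>-\<^sup>1 A)\<close> for \<open>A = \<tau>\<^sup>n\<^sup>+\<^sup>1(X)\<close> only \<open>\<sigma> = \<tau>\<close> then contributes, which gives
  the recurrence \<open>\<mu>(\<tau>\<^sup>n\<^sup>+\<^sup>1(X)) = p\<^sub>\<tau> \<mu>(\<tau>\<^sup>n(X))\<close> and hence the claim with \<open>C = \<mu>(\<tau>\<^sup>n\<^sup>0(X)) / p\<^sub>\<tau>\<^sup>n\<^sup>0\<close>.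
\<close>

text \<open>The cartesian matrices of HOL-Analysis and the list-based matrices of the Jordan normal
  form library share the names \<open>mat\<close>, \<open>vec\<close>, \<open>det\<close> and the indexing infix \<open>$\<close>; unqualified, they
  refer to the cartesian notions in this theory.\<close>
no_notation vec_index (infixl "$" 100)
hide_const (open) Matrix.mat Matrix.vec Determinant.det

text \<open>Scaling a matrix by \<open>a\<close> scales its \<open>k\<close>-th power by \<open>a ^ k\<close>.\<close>
lemma pow_mat_smult:
  assumes M: "(M :: 'a::comm_ring_1 mat) \<in> carrier_mat n n"
  shows "(a \<cdot>\<^sub>m M) ^\<^sub>m k = (a ^ k) \<cdot>\<^sub>m (M ^\<^sub>m k)"
proof (induction k)
  case 0
  then show ?case by (auto intro!: eq_matI)
next
  case (Suc k)
  have Mk: "M ^\<^sub>m k \<in> carrier_mat n n" using M by simp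
  have "(a \<cdot>\<^sub>m M) ^\<^sub>m Suc k = ((a ^ k) \<cdot>\<^sub>m (M ^\<^sub>m k)) * (a \<cdot>\<^sub>m M)" using Suc by simp
  also have "\<dots> = (a ^ k) \<cdot>\<^sub>m (M ^\<^sub>m k * (a \<cdot>\<^sub>m M))"
    by (rule mult_smult_assoc_mat[OF Mk, of _ n]) (use M in simp)
  also have "\<dots> = (a ^ k) \<cdot>\<^sub>m (a \<cdot>\<^sub>m (M ^\<^sub>m k * M))"
    using Mk M by (simp add: mult_smult_distrib[of _ n n _ n])
  also have "\<dots> = (a ^ Suc k) \<cdot>\<^sub>m (M ^\<^sub>m Suc k)"
    using Mk M by (intro eq_matI) (auto simp: mult.assoc)
  finally show ?case .
qed

text \<open>If all eigenvalues of a complex square matrix lie in the open unit disc, the entries of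
  its powers decay exponentially.  Take \<open>\<rho>\<close> halfway between the spectral radius and 1: the
  rescaled matrix \<open>M / \<rho>\<close> still has spectral radius below 1, hence bounded powers (Jordan
  normal form).\<close>
lemma power_entries_decay:
  fixes M :: "complex mat"
  assumes M: "M \<in> carrier_mat n n" and n: "n > 0"
    and eig: "\<And>l. eigenvalue M l \<Longrightarrow> norm l < 1"
  obtains \<rho> c where "0 < \<rho>" "\<rho> < 1"
    "\<And>k i j. i < n \<Longrightarrow> j < n \<Longrightarrow> norm ((M ^\<^sub>m k) $$ (i,j)) \<le> c * \<rho> ^ k"
proof -
  define s where "s = spectral_radius M"
  obtain l where l: "eigenvalue M l" "s = norm l"
    using spectral_radius_mem_max(1)[OF M n] unfolding s_def spectrum_def by auto
  have s: "0 \<le> s" "s < 1" using l eig by auto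
  define \<rho> where "\<rho> = (1 + s) / 2"
  have \<rho>: "0 < \<rho>" "\<rho> < 1" "s < \<rho>" using s unfolding \<rho>_def by auto
  define A where "A = (1 / complex_of_real \<rho>) \<cdot>\<^sub>m M"
  have A: "A \<in> carrier_mat n n" using M A_def by simp
  have "spectral_radius A < 1"
  proof -
    obtain l' v where v: "eigenvector A v l'" and l': "spectral_radius A = norm l'"
      using spectral_radius_mem_max(1)[OF A n] unfolding spectrum_def eigenvalue_def by auto
    have vc: "v \<in> carrier_vec n" using v A unfolding eigenvector_def by auto
    have "M *\<^sub>v v = complex_of_real \<rho> \<cdot>\<^sub>v (A *\<^sub>v v)"
      using vc M \<rho> unfolding A_def by (intro eq_vecI) (auto simp: scalar_prod_def sum_distrib_left)
    also have "\<dots> = (complex_of_real \<rho> * l') \<cdot>\<^sub>v v"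
      using v unfolding eigenvector_def by (simp add: smult_smult_assoc)
    finally have "eigenvalue M (complex_of_real \<rho> * l')"
      using v A M unfolding eigenvalue_def eigenvector_def by auto
    hence "norm (complex_of_real \<rho> * l') \<le> s"
      using spectral_radius_mem_max(2)[OF M n] unfolding s_def spectrum_def by auto
    hence "\<rho> * norm l' \<le> s" using \<rho> by (simp add: norm_mult)
    hence "\<rho> * norm l' < \<rho> * 1" using \<rho>(3) by simp
    with \<rho> l' show ?thesis by (simp only: mult_less_cancel_left_pos)
  qed
  then obtain c where c: "\<And>k. norm_bound (A ^\<^sub>m k) c"
    using spectral_radius_jnf_norm_bound_less_1_upper_triangular[OF A] by auto
  show ?thesis
  proof
    fix k i j assume ij: "i < n" "j < n"
    have "A ^\<^sub>m k = ((1 / complex_of_real \<rho>) ^ k) \<cdot>\<^sub>m (M ^\<^sub>m k)"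
      unfolding A_def using pow_mat_smult[OF M] by simp
    hence "norm ((A ^\<^sub>m k) $$ (i,j)) = norm ((M ^\<^sub>m k) $$ (i,j)) / \<rho> ^ k"
      using ij M \<rho> by (simp add: norm_mult norm_divide norm_power power_one_over)
    moreover have "norm ((A ^\<^sub>m k) $$ (i,j)) \<le> c" using c[of k] ij A unfolding norm_bound_def by auto
    ultimately show "norm ((M ^\<^sub>m k) $$ (i,j)) \<le> c * \<rho> ^ k"
      using \<rho> by (simp add: divide_le_eq mult.commute)
  qed (use \<rho> in auto)
qed

text \<open>To use these results for matrices of type \<open>'a^'n^'n\<close> we fix an enumeration of the finite
  index type and translate matrices and vectors into the list-based representation.\<close>
definition index_enum :: "nat \<Rightarrow> 'n::finite" where
  "index_enum = (SOME e. bij_betw e {..<CARD('n)} UNIV)"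

definition mat_of_cart :: "'a^'n^'n \<Rightarrow> 'a mat" where
  "mat_of_cart M = Matrix.mat CARD('n) CARD('n) (\<lambda>(i, j). M $ index_enum i $ index_enum j)"

definition vec_of_cart :: "'a^'n \<Rightarrow> 'a vec" where
  "vec_of_cart x = Matrix.vec CARD('n) (\<lambda>i. x $ index_enum i)"

lemma bij_index_enum: "bij_betw (index_enum :: nat \<Rightarrow> 'n::finite) {..<CARD('n)} UNIV"
proof -
  have "\<exists>e :: nat \<Rightarrow> 'n. bij_betw e {..<CARD('n)} UNIV"
    using ex_bij_betw_nat_finite[of "UNIV :: 'n set"] by (auto simp: lessThan_atLeast0)
  then show ?thesis unfolding index_enum_def by (rule someI_ex)
qed

lemma mat_of_cart_carrier [simp]: "mat_of_cart (M :: 'a^'n^'n) \<in> carrier_mat CARD('n) CARD('n)"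
  by (simp add: mat_of_cart_def)

lemma vec_of_cart_carrier [simp]: "vec_of_cart (x :: 'a^'n) \<in> carrier_vec CARD('n)"
  by (simp add: vec_of_cart_def)

lemma index_enum_surj: "\<exists>i < CARD('n). index_enum i = (a :: 'n::finite)"
  using bij_index_enum[where 'n='n] unfolding bij_betw_def by (metis UNIV_I imageE lessThan_iff)

lemma vec_of_cart_inj:
  assumes "vec_of_cart x = vec_of_cart (y :: 'a^'n)"
  shows "x = y"
proof -
  have "x $ a = y $ a" for a
  proof -
    obtain i where i: "i < CARD('n)" "index_enum i = a" using index_enum_surj by blast
    show ?thesis using arg_cong[OF assms, of "\<lambda>v. vec_index v i"] i by (simp add: vec_of_cart_def)
  qed
  then show ?thesis by (simp add: Finite_Cartesian_Product.vec_eq_iff)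
qed

lemma vec_of_cart_surj:
  assumes v: "v \<in> carrier_vec CARD('n)"
  shows "\<exists>x :: 'a^'n. v = vec_of_cart x"
proof
  define inv_enum where "inv_enum = inv_into {..<CARD('n)} (index_enum :: nat \<Rightarrow> 'n)"
  have "inv_enum (index_enum i) = i" if "i < CARD('n)" for i
    using bij_index_enum[where 'n='n] that unfolding inv_enum_def by (simp add: bij_betw_def inv_into_f_f)
  then show "v = vec_of_cart (\<chi> a. vec_index v (inv_enum a))"
    using v by (intro eq_vecI) (auto simp: vec_of_cart_def)
qed

lemma vec_of_cart_zero [simp]: "vec_of_cart (0 :: 'a::zero^'n) = 0\<^sub>v CARD('n)"
  by (intro eq_vecI) (auto simp: vec_of_cart_def)

lemma vec_of_cart_smult: "l \<cdot>\<^sub>v vec_of_cart x = vec_of_cart (l *s (x :: 'a::times^'n))"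
  by (intro eq_vecI) (auto simp: vec_of_cart_def)

lemma mat_of_cart_mult_vec:
  "mat_of_cart M *\<^sub>v vec_of_cart x = vec_of_cart (M *v (x :: 'a::semiring_1^'n))"
proof (rule eq_vecI)
  fix i assume "i < dim_vec (vec_of_cart (M *v x))"
  then show "vec_index (mat_of_cart M *\<^sub>v vec_of_cart x) i = vec_index (vec_of_cart (M *v x)) i"
    by (simp add: mat_of_cart_def vec_of_cart_def matrix_vector_mult_def scalar_prod_def
        atLeast0LessThan) (rule sum.reindex_bij_betw[OF bij_index_enum])
qed (simp add: mat_of_cart_def vec_of_cart_def)

lemma mat_of_cart_pow_mult_vec:
  "(mat_of_cart M ^\<^sub>m k) *\<^sub>v vec_of_cart x = vec_of_cart ((((*v) M) ^^ k) (x :: 'a::comm_ring_1^'n))"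
proof (induction k arbitrary: x)
  case 0
  then show ?case by (simp add: mat_of_cart_def)
next
  case (Suc k)
  have "(mat_of_cart M ^\<^sub>m Suc k) *\<^sub>v vec_of_cart x = (mat_of_cart M ^\<^sub>m k) *\<^sub>v (mat_of_cart M *\<^sub>v vec_of_cart x)"
    by (simp add: assoc_mult_mat_vec[of _ "CARD('n)" "CARD('n)" _ "CARD('n)"])
  also have "\<dots> = vec_of_cart ((((*v) M) ^^ Suc k) x)"
    by (simp add: mat_of_cart_mult_vec Suc.IH funpow_Suc_right del: funpow.simps)
  finally show ?case .
qed

text \<open>Eigenvalues of the translated matrix are eigenvalues of the cartesian one.\<close>
lemma eigenvalue_mat_of_cart:
  fixes M :: "'a::field^'n^'n"
  assumes "eigenvalue (mat_of_cart M) l"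
  shows "\<exists>x. x \<noteq> 0 \<and> M *v x = l *s x"
proof -
  obtain v where v: "v \<in> carrier_vec CARD('n)" "v \<noteq> 0\<^sub>v CARD('n)" "mat_of_cart M *\<^sub>v v = l \<cdot>\<^sub>v v"
    using assms mat_of_cart_carrier[of M] unfolding eigenvalue_def eigenvector_def by auto
  obtain x :: "'a^'n" where x: "v = vec_of_cart x" using vec_of_cart_surj v(1) by blast
  have "x \<noteq> 0" using v x by auto
  moreover have "M *v x = l *s x"
    using v x by (intro vec_of_cart_inj) (simp add: mat_of_cart_mult_vec vec_of_cart_smult)
  ultimately show ?thesis by blast
qed

text \<open>A bound \<open>b\<close> on the entries of the translated power \<open>M\<^sup>m\<close> bounds its operator norm by \<open>d\<^sup>2 b\<close>,
  \<open>d\<close> being the dimension.\<close>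
lemma norm_cart_power_le:
  fixes M :: "complex^'n^'n"
  assumes b: "\<And>i j. i < CARD('n) \<Longrightarrow> j < CARD('n) \<Longrightarrow> norm ((mat_of_cart M ^\<^sub>m m) $$ (i,j)) \<le> b"
  shows "norm ((((*v) M) ^^ m) x) \<le> real CARD('n) * real CARD('n) * b * norm x"
proof -
  define n where "n = CARD('n)"
  define A where "A = mat_of_cart M ^\<^sub>m m"
  have A: "A \<in> carrier_mat n n" by (simp add: A_def n_def)
  have component: "norm ((((*v) M) ^^ m) x $ a) \<le> real n * (b * norm x)" for a
  proof -
    obtain i where i: "i < n" "index_enum i = a" using index_enum_surj n_def by blast
    have "(((*v) M) ^^ m) x $ a = vec_index (A *\<^sub>v vec_of_cart x) i"
      using i unfolding A_def mat_of_cart_pow_mult_vec by (simp add: vec_of_cart_def n_def)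
    also have "\<dots> = (\<Sum>j<n. A $$ (i,j) * vec_index (vec_of_cart x) j)"
      using i A by (simp add: scalar_prod_def atLeast0LessThan n_def vec_of_cart_def)
    finally have "norm ((((*v) M) ^^ m) x $ a)
        \<le> (\<Sum>j<n. norm (A $$ (i,j)) * norm (vec_index (vec_of_cart x) j))"
      by (simp add: order_trans[OF norm_sum] norm_mult)
    also have "\<dots> \<le> (\<Sum>j<n. b * norm x)"
    proof (rule sum_mono)
      fix j assume j: "j \<in> {..<n}"
      have "norm (vec_index (vec_of_cart x) j) \<le> norm x"
        using j by (simp add: vec_of_cart_def n_def Finite_Cartesian_Product.norm_nth_le)
      moreover have "norm (A $$ (i,j)) \<le> b" using b i j by (simp add: A_def n_def)
      ultimately show "norm (A $$ (i,j)) * norm (vec_index (vec_of_cart x) j) \<le> b * norm x"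
        by (intro mult_mono) (auto intro: order_trans[OF norm_ge_zero])
    qed
    finally show ?thesis by simp
  qed
  have "norm ((((*v) M) ^^ m) x) \<le> (\<Sum>a\<in>UNIV. norm ((((*v) M) ^^ m) x $ a))"
    unfolding norm_vec_def by (rule L2_set_le_sum) simp
  also have "\<dots> \<le> (\<Sum>a\<in>(UNIV :: 'n set). real n * (b * norm x))"
    by (intro sum_mono component)
  finally show ?thesis by (simp add: n_def)
qed

text \<open>A complex matrix all of whose eigenvalues lie in the open unit disc is eventually
  contracting: its powers decay exponentially in operator norm.\<close>
lemma cart_matrix_power_decay:
  fixes M :: "complex^'n^'n"
  assumes eig: "\<And>l x. x \<noteq> 0 \<Longrightarrow> M *v x = l *s x \<Longrightarrow> cmod l < 1"
  obtains K \<rho> where "0 < K" "0 < \<rho>" "\<rho> < 1"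
    "\<And>m x. norm ((((*v) M) ^^ m) x) \<le> K * \<rho> ^ m * norm x"
proof -
  define n where "n = CARD('n)"
  have A: "mat_of_cart M \<in> carrier_mat n n" and n: "0 < n" by (simp_all add: n_def)
  have "norm l < 1" if "eigenvalue (mat_of_cart M) l" for l
    using eigenvalue_mat_of_cart[OF that] eig by blast
  then obtain \<rho> c where \<rho>: "0 < \<rho>" "\<rho> < 1"
    and c: "\<And>k i j. i < n \<Longrightarrow> j < n \<Longrightarrow> norm ((mat_of_cart M ^\<^sub>m k) $$ (i,j)) \<le> c * \<rho> ^ k"
    using power_entries_decay[OF A n] by blast
  have "1 \<le> c" using c[OF n n, of 0] n A by simp
  show ?thesis
  proof
    show "0 < real n * real n * c" using \<open>1 \<le> c\<close> n by simp
    show "norm ((((*v) M) ^^ m) x) \<le> real n * real n * c * \<rho> ^ m * norm x" for m x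
      using norm_cart_power_le[of M m "c * \<rho> ^ m" x] c unfolding n_def by (simp add: mult.assoc)
  qed (use \<rho> in auto)
qed

text \<open>The complexification of real matrices and vectors, used to speak about complex eigenvalues.\<close>
definition cmat :: "real^'n^'n \<Rightarrow> complex^'n^'n" where
  "cmat A = (\<chi> i j. complex_of_real (A $ i $ j))"

definition cvec :: "real^'n \<Rightarrow> complex^'n" where
  "cvec x = (\<chi> i. complex_of_real (x $ i))"

lemma cmat_mult_cvec: "cmat A *v cvec x = cvec (A *v x)"
  by (simp add: cmat_def cvec_def matrix_vector_mult_def Finite_Cartesian_Product.vec_eq_iff)

lemma cmat_mult: "cmat A ** cmat B = cmat (A ** B)"
  by (simp add: cmat_def matrix_matrix_mult_def Finite_Cartesian_Product.vec_eq_iff)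

lemma cmat_one: "cmat (mat 1) = mat 1"
  by (simp add: cmat_def Finite_Cartesian_Product.mat_def Finite_Cartesian_Product.vec_eq_iff)

lemma cvec_eq_0_iff [simp]: "cvec x = 0 \<longleftrightarrow> x = 0"
  by (simp add: cvec_def Finite_Cartesian_Product.vec_eq_iff)

lemma norm_cvec [simp]: "norm (cvec x) = norm x"
  by (simp add: cvec_def norm_vec_def)

lemma cmat_funpow_cvec: "(((*v) (cmat A)) ^^ m) (cvec x) = cvec ((((*v) A) ^^ m) x)"
  by (induction m) (simp_all add: cmat_mult_cvec)

text \<open>A square matrix with a nonzero kernel vector is singular.\<close>
lemma det_eq_0_if_kernel:
  fixes M :: "'a::field^'n^'n"
  assumes "M *v x = 0" "x \<noteq> 0"
  shows "det M = 0"
  using assms invertible_det_nz invertible_left_inverse matrix_left_invertible_ker by metis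

text \<open>Expansiveness, phrased with eigenvectors: every complex eigenvalue of \<open>R\<close> exceeds 1 in
  modulus.\<close>
lemma expansive_eigenvalue:
  assumes exp: "expansive R" and w: "cmat R *v w = l *s w" "w \<noteq> 0"
  shows "1 < cmod l"
proof -
  define M where "M = (\<chi> i j. complex_of_real (R $ i $ j) - (if i = j then l else 0))"
  have "M *v w = cmat R *v w - l *s w"
    by (simp add: M_def cmat_def matrix_vector_mult_def Finite_Cartesian_Product.vec_eq_iff
        left_diff_distrib sum_subtractf if_distrib[of "\<lambda>x. x * _"] cong: if_cong)
  with w have "det M = 0" by (intro det_eq_0_if_kernel[of M w]) auto
  with exp show ?thesis unfolding expansive_def M_def by blast
qed

lemma expansive_invertible:
  assumes "expansive R"
  shows "invertible R"
proof -
  have "x = 0" if "R *v x = 0" for x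
  proof (rule ccontr)
    assume "x \<noteq> 0"
    moreover have "cmat R *v cvec x = 0 *s cvec x" using that by (simp add: cmat_mult_cvec)
    ultimately have "1 < cmod 0" using expansive_eigenvalue[OF assms] by (metis cvec_eq_0_iff)
    then show False by simp
  qed
  then show ?thesis by (simp add: invertible_left_inverse matrix_left_invertible_ker)
qed

lemma matrix_inv_inverse:
  assumes "invertible (R :: 'a::semiring_1^'n^'n)"
  shows "R ** matrix_inv R = mat 1" "matrix_inv R ** R = mat 1"
  using someI_ex[OF assms[unfolded invertible_def]] unfolding matrix_inv_def by auto

text \<open>The inverse of an expansive matrix has all its complex eigenvalues inside the unit disc.\<close>
lemma expansive_inverse_eigenvalue:
  assumes exp: "expansive R" and w: "cmat (matrix_inv R) *v w = l *s w" "w \<noteq> 0"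
  shows "cmod l < 1"
proof -
  have "cmat R ** cmat (matrix_inv R) = mat 1"
    using matrix_inv_inverse[OF expansive_invertible[OF exp]] by (simp add: cmat_mult cmat_one)
  then have eq: "w = l *s (cmat R *v w)"
    using w by (metis matrix_vector_mul_assoc matrix_vector_mul_lid vector_scalar_commute)
  with w have l: "l \<noteq> 0" by auto
  from arg_cong[OF eq, of "\<lambda>v. (1 / l) *s v"] l
  have "cmat R *v w = (1 / l) *s w" by (simp add: vector_smult_assoc)
  then have "1 < cmod (1 / l)" using exp w(2) by (intro expansive_eigenvalue)
  with l show ?thesis by (simp add: norm_divide divide_less_eq)
qed

text \<open>Hence the powers of \<open>R\<^sup>-\<^sup>1\<close> contract exponentially.\<close>
lemma expansive_inverse_power_decay:
  assumes exp: "expansive R"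
  obtains K \<rho> where "0 < K" "0 < \<rho>" "\<rho> < 1"
    "\<And>m x. norm ((((*v) (matrix_inv R)) ^^ m) x) \<le> K * \<rho> ^ m * norm x"
proof -
  obtain K \<rho> where K: "0 < K" "0 < \<rho>" "\<rho> < 1"
    and decay: "\<And>m z. norm ((((*v) (cmat (matrix_inv R))) ^^ m) z) \<le> K * \<rho> ^ m * norm z"
    using cart_matrix_power_decay expansive_inverse_eigenvalue[OF exp] by metis
  show ?thesis
  proof
    show "norm ((((*v) (matrix_inv R)) ^^ m) x) \<le> K * \<rho> ^ m * norm x" for m x
      using decay[of m "cvec x"] by (simp add: cmat_funpow_cvec)
  qed (use K in auto)
qed

lemma word_map_Nil [simp]: "word_map R [] = id"
  by (simp add: word_map_def)

lemma word_map_Cons [simp]: "word_map R (b # w) = ifs_map R b \<circ> word_map R w"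
  by (simp add: word_map_def)

lemma word_map_append: "word_map R (u @ v) = word_map R u \<circ> word_map R v"
  by (induction u) (simp_all add: comp_assoc)

text \<open>Iterating the map of a word is the map of the repeated word; in particular the iterates
  \<open>\<tau>\<^sup>n\<close> of \<open>\<tau> \<in> \<A>\<^sub>k\<close> lie in \<open>\<A>\<^sub>k\<^sub>n\<close>.\<close>
lemma word_map_funpow: "word_map R w ^^ n = word_map R (concat (replicate n w))"
  by (induction n) (simp_all add: word_map_append)

lemma word_weight_Nil [simp]: "word_weight p [] = 1"
  by (simp add: word_weight_def)

lemma word_weight_Cons [simp]: "word_weight p (b # w) = p b * word_weight p w"
  by (simp add: word_weight_def)

lemma words_0: "words B 0 = {[]}"
  by (auto simp: words_def)

lemma words_Suc: "words B (Suc m) = (\<lambda>(b, w). b # w) ` (B \<times> words B m)"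
  by (auto simp: words_def length_Suc_conv)

lemma finite_words: "finite B \<Longrightarrow> finite (words B m)"
  unfolding words_def by (rule finite_lists_length_eq)

lemma sum_words_Suc: "(\<Sum>w\<in>words B (Suc m). f w) = (\<Sum>b\<in>B. \<Sum>w\<in>words B m. f (b # w))"
proof -
  have "inj_on (\<lambda>(b, w). b # w) (B \<times> words B m)" by (auto simp: inj_on_def)
  then show ?thesis
    unfolding words_Suc by (simp add: sum.reindex sum.cartesian_product prod.case_distrib)
qed

text \<open>The weights of the words of a fixed length form a probability vector.\<close>
lemma sum_word_weight:
  assumes "(\<Sum>b\<in>B. p b) = 1"
  shows "(\<Sum>w\<in>words B m. word_weight p w) = 1"
proof (induction m)
  case 0
  then show ?case by (simp add: words_0)
next
  case (Suc m)
  then show ?case using assms by (simp add: sum_words_Suc sum_distrib_left[symmetric])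
qed

lemma word_weight_pos:
  assumes "\<forall>b\<in>B. p b > 0" "w \<in> words B m"
  shows "word_weight p w > 0"
  using assms unfolding words_def word_weight_def
  by (induction w arbitrary: m) auto

text \<open>The weight \<open>p\<^sub>\<tau>\<close> of a map in \<open>\<A>\<^sub>k\<close> is positive.\<close>
lemma map_weight_pos:
  assumes "finite B" "\<forall>b\<in>B. p b > 0" "tau \<in> maps_level R B k"
  shows "map_weight R B p k tau > 0"
proof -
  obtain w where w: "w \<in> words B k" "word_map R w = tau"
    using assms(3) unfolding maps_level_def by auto
  show ?thesis
    unfolding map_weight_def using w finite_words[OF assms(1)] word_weight_pos[OF assms(2)]
    by (intro sum_pos2[of _ w]) (auto intro: less_imp_le)
qed

text \<open>The linear part of \<open>\<tau>\<^sub>I\<close> is \<open>R\<^sup>-\<^sup>|\<^sup>I\<^sup>|\<close>.\<close>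
lemma ifs_map_diff: "ifs_map R b x - ifs_map R b y = matrix_inv R *v (x - y)"
  by (simp add: ifs_map_def matrix_vector_right_distrib matrix_vector_mult_diff_distrib)

lemma word_map_diff:
  "word_map R w x - word_map R w y = (((*v) (matrix_inv R)) ^^ length w) (x - y)"
  by (induction w) (simp_all add: ifs_map_diff)

text \<open>For expansive \<open>R\<close> the maps \<open>\<tau>\<^sub>I\<close> contract uniformly exponentially in the length of \<open>I\<close>.\<close>
lemma word_map_contraction:
  assumes "expansive R"
  obtains K \<rho> where "0 < K" "0 < \<rho>" "\<rho> < 1"
    "\<And>w x y. dist (word_map R w x) (word_map R w y) \<le> K * \<rho> ^ length w * dist x y"
proof -
  obtain K \<rho> where K: "0 < K" "0 < \<rho>" "\<rho> < 1"
    and decay: "\<And>m z. norm ((((*v) (matrix_inv R)) ^^ m) z) \<le> K * \<rho> ^ m * norm z"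
    using expansive_inverse_power_decay[OF assms] by blast
  show ?thesis
  proof (rule that[OF K])
    show "dist (word_map R w x) (word_map R w y) \<le> K * \<rho> ^ length w * dist x y" for w x y
      using decay[of "length w" "x - y"] by (simp add: dist_norm word_map_diff)
  qed
qed

lemma continuous_word_map: "continuous_on UNIV (word_map R w)"
proof (induction w)
  case Nil
  then show ?case by (simp add: continuous_on_id)
next
  case (Cons b w)
  have "continuous_on UNIV (ifs_map R b)"
    unfolding ifs_map_def
    by (intro continuous_on_compose2[OF linear_continuous_on[OF matrix_vector_mul_bounded_linear]]
        continuous_intros) auto
  with Cons show ?case by (auto intro: continuous_on_compose2)
qed

lemma borel_vimage_word_map: "A \<in> sets borel \<Longrightarrow> word_map R w -` A \<in> sets borel"
  using measurable_sets_borel[OF borel_measurable_continuous_onI[OF continuous_word_map]] .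

lemma compact_image_word_map: "compact X \<Longrightarrow> compact (word_map R w ` X)"
  by (rule compact_continuous_image[OF continuous_on_subset[OF continuous_word_map]]) auto

lemma inj_word_map:
  assumes "invertible R"
  shows "inj (word_map R w)"
proof (induction w)
  case Nil
  then show ?case by simp
next
  case (Cons b w)
  have "inj (ifs_map R b)"
  proof (rule injI)
    fix x y assume "ifs_map R b x = ifs_map R b y"
    then have "R *v (matrix_inv R *v (x + b)) = R *v (matrix_inv R *v (y + b))"
      by (simp add: ifs_map_def)
    then show "x = y" by (simp add: matrix_vector_mul_assoc matrix_inv_inverse[OF assms])
  qed
  with Cons.IH show ?case unfolding word_map_Cons by (rule inj_compose[rotated])
qed

text \<open>The maps \<open>\<tau>\<^sub>I\<close> leave the attractor invariant.\<close>
lemma word_map_attractor: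
  assumes "is_attractor R B X" "set w \<subseteq> B"
  shows "word_map R w ` X \<subseteq> X"
  using assms(2)
proof (induction w)
  case Nil
  then show ?case by simp
next
  case (Cons b w)
  have "ifs_map R b ` X \<subseteq> X" using assms(1) Cons.prems unfolding is_attractor_def by auto
  with Cons show ?case by (auto simp: image_comp[symmetric])
qed

text \<open>Iterated invariance: \<open>\<mu> = \<Sum>\<^sub>|\<^sub>I\<^sub>|\<^sub>=\<^sub>m p\<^sub>I \<mu> \<circ> \<tau>\<^sub>I\<^sup>-\<^sup>1\<close>.\<close>
lemma measure_words:
  assumes inv: "is_invariant_measure R B p \<mu>" and A: "A \<in> sets borel"
  shows "measure \<mu> A = (\<Sum>w\<in>words B m. word_weight p w * measure \<mu> (word_map R w -` A))"
  using A
proof (induction m arbitrary: A)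
  case 0
  then show ?case by (simp add: words_0)
next
  case (Suc m)
  have "measure \<mu> A = (\<Sum>b\<in>B. p b * measure \<mu> (ifs_map R b -` A))"
    using inv Suc.prems unfolding is_invariant_measure_def by blast
  also have "\<dots> = (\<Sum>b\<in>B. \<Sum>w\<in>words B m. p b * word_weight p w *
      measure \<mu> (word_map R w -` (ifs_map R b -` A)))"
  proof -
    have "ifs_map R b -` A \<in> sets borel" for b
      using borel_vimage_word_map[OF Suc.prems, of R "[b]"] by simp
    then show ?thesis using Suc.IH by (simp add: sum_distrib_left mult.assoc)
  qed
  also have "\<dots> = (\<Sum>w\<in>words B (Suc m). word_weight p w * measure \<mu> (word_map R w -` A))"
    by (simp add: sum_words_Suc vimage_comp)
  finally show ?case .
qed

text \<open>A self-map of \<open>X\<close> which is \<open>c\<close>-Lipschitz on the whole space moves points at most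
  \<open>c\<close> times closer to \<open>X\<close>.\<close>
lemma infdist_lipschitz_self_map:
  assumes X: "X \<noteq> {}" "f ` X \<subseteq> X" and c: "0 < c"
    and lip: "\<And>x. x \<in> X \<Longrightarrow> dist (f y) (f x) \<le> c * dist y x"
  shows "infdist (f y) X \<le> c * infdist y X"
proof -
  have "infdist (f y) X / c \<le> dist y x" if x: "x \<in> X" for x
  proof -
    have "infdist (f y) X \<le> dist (f y) (f x)" using X x by (intro infdist_le) auto
    also have "\<dots> \<le> c * dist y x" by (rule lip[OF x])
    finally show ?thesis using c by (simp add: pos_divide_le_eq mult.commute)
  qed
  then have "infdist (f y) X / c \<le> infdist y X"
    unfolding infdist_notempty[OF X(1)] by (intro cINF_greatest X(1))
  with c show ?thesis by (simp add: pos_divide_le_eq mult.commute)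
qed

text \<open>The points at distance at least \<open>t\<close> from a set \<open>X\<close>.\<close>
definition far_from :: "'a::metric_space set \<Rightarrow> real \<Rightarrow> 'a set" where
  "far_from X t = {y. t \<le> infdist y X}"

lemma far_from_borel: "far_from X t \<in> sets borel"
  by (simp add: far_from_def borel_closed closed_Collect_le continuous_intros)

lemma far_from_antimono: "t \<le> t' \<Longrightarrow> far_from X t' \<subseteq> far_from X t"
  by (auto simp: far_from_def)

text \<open>For a finite Borel measure, the mass far from a fixed set vanishes at infinity.\<close>
lemma measure_far_from_tendsto_0:
  assumes "finite_measure M" "sets M = sets borel"
  shows "(\<lambda>j. measure M (far_from X (real j))) \<longlonglongrightarrow> 0"
proof -
  interpret finite_measure M by (fact assms(1))
  have "(\<lambda>j. measure M (far_from X (real j))) \<longlonglongrightarrow> measure M (\<Inter>j. far_from X (real j))"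
    using far_from_borel assms(2)
    by (intro finite_Lim_measure_decseq) (auto simp: decseq_def intro!: far_from_antimono)
  moreover have "(\<Inter>j. far_from X (real j)) = {}"
  proof -
    have "y \<notin> (\<Inter>j. far_from X (real j))" for y
    proof -
      obtain j :: nat where "infdist y X < real j" using reals_Archimedean2 by blast
      then show ?thesis by (auto simp: far_from_def not_le)
    qed
    then show ?thesis by blast
  qed
  ultimately show ?thesis by simp
qed

text \<open>Iterated invariance together with the contraction of the \<open>\<tau>\<^sub>I\<close>, \<open>|I| = m\<close>, shows that the
  mass at distance \<open>\<ge> \<delta>\<close> from the attractor is at most the mass at distance \<open>\<ge> \<delta> / (K \<rho>\<^sup>m)\<close>.\<close>
lemma measure_far_from_attractor_le:
  assumes pos: "\<forall>b\<in>B. p b > 0" and sum1: "(\<Sum>b\<in>B. p b) = 1"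
    and att: "is_attractor R B X" and inv: "is_invariant_measure R B p \<mu>"
    and K: "0 < K" "0 < \<rho>"
    and contr: "\<And>w x y. dist (word_map R w x) (word_map R w y) \<le> K * \<rho> ^ length w * dist x y"
  shows "measure \<mu> (far_from X \<delta>) \<le> measure \<mu> (far_from X (\<delta> / (K * \<rho> ^ m)))"
proof -
  interpret prob_space \<mu> using inv by (simp add: is_invariant_measure_def)
  have sets_\<mu>: "sets \<mu> = sets borel" using inv by (simp add: is_invariant_measure_def)
  have Kpos: "0 < K * \<rho> ^ m" using K by simp
  have "word_map R w -` far_from X \<delta> \<subseteq> far_from X (\<delta> / (K * \<rho> ^ m))" if w: "w \<in> words B m" for w
  proof
    fix y assume "y \<in> word_map R w -` far_from X \<delta>"
    then have "\<delta> \<le> infdist (word_map R w y) X" by (simp add: far_from_def)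
    also have "\<dots> \<le> K * \<rho> ^ m * infdist y X"
      using w contr word_map_attractor[OF att] att Kpos
      by (intro infdist_lipschitz_self_map) (auto simp: words_def is_attractor_def)
    finally show "y \<in> far_from X (\<delta> / (K * \<rho> ^ m))"
      using Kpos by (simp add: far_from_def pos_divide_le_eq mult.commute)
  qed
  then have "(\<Sum>w\<in>words B m. word_weight p w * measure \<mu> (word_map R w -` far_from X \<delta>))
      \<le> (\<Sum>w\<in>words B m. word_weight p w * measure \<mu> (far_from X (\<delta> / (K * \<rho> ^ m))))"
    using word_weight_pos[OF pos] far_from_borel sets_\<mu>
    by (intro sum_mono mult_left_mono finite_measure_mono) (auto intro: less_imp_le)
  then show ?thesis
    using measure_words[OF inv far_from_borel] sum_word_weight[OF sum1]
    by (simp add: sum_distrib_right[symmetric])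
qed

text \<open>Hence there is no mass at positive distance from the attractor: otherwise it would be
  dominated by the mass arbitrarily far away, which tends to 0.\<close>
lemma measure_far_from_attractor_0:
  assumes exp: "expansive R" and pos: "\<forall>b\<in>B. p b > 0" and sum1: "(\<Sum>b\<in>B. p b) = 1"
    and att: "is_attractor R B X" and inv: "is_invariant_measure R B p \<mu>" and \<delta>: "\<delta> > 0"
  shows "measure \<mu> (far_from X \<delta>) = 0"
proof (rule ccontr)
  interpret prob_space \<mu> using inv by (simp add: is_invariant_measure_def)
  have sets_\<mu>: "sets \<mu> = sets borel" using inv by (simp add: is_invariant_measure_def)
  obtain K \<rho> where K: "0 < K" "0 < \<rho>" "\<rho> < 1"
    and contr: "\<And>w x y. dist (word_map R w x) (word_map R w y) \<le> K * \<rho> ^ length w * dist x y"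
    using word_map_contraction[OF exp] by blast
  assume "measure \<mu> (far_from X \<delta>) \<noteq> 0"
  then have "measure \<mu> (far_from X \<delta>) > 0" using measure_nonneg[of \<mu> "far_from X \<delta>"] by linarith
  from order_tendstoD(2)[OF measure_far_from_tendsto_0[OF finite_measure_axioms sets_\<mu>] this]
  obtain J where J: "measure \<mu> (far_from X (real J)) < measure \<mu> (far_from X \<delta>)"
    by (auto simp: eventually_sequentially)
  have "(\<lambda>m. K * \<rho> ^ m) \<longlonglongrightarrow> 0"
    using K by (intro tendsto_mult_right_zero LIMSEQ_realpow_zero) auto
  from order_tendstoD(2)[OF this, of "\<delta> / (real J + 1)"] \<delta> obtain m
    where "K * \<rho> ^ m < \<delta> / (real J + 1)"
    by (auto simp: eventually_sequentially)
  then have "(real J + 1) * (K * \<rho> ^ m) < \<delta>" by (simp add: pos_less_divide_eq mult.commute)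
  moreover have "0 < K * \<rho> ^ m" using K by simp
  ultimately have "real J \<le> \<delta> / (K * \<rho> ^ m)" by (simp add: pos_le_divide_eq distrib_right)
  then have "measure \<mu> (far_from X (\<delta> / (K * \<rho> ^ m))) \<le> measure \<mu> (far_from X (real J))"
    using far_from_borel sets_\<mu> by (intro finite_measure_mono far_from_antimono) auto
  with measure_far_from_attractor_le[OF pos sum1 att inv K(1,2) contr, of \<delta> m] J
  show False by simp
qed

text \<open>The invariant measure is supported on the attractor: a Borel set disjoint from the closed
  set \<open>X\<close> is covered by the null sets \<open>far_from X (1 / (j + 1))\<close>.\<close>
lemma invariant_measure_support:
  assumes exp: "expansive R" and pos: "\<forall>b\<in>B. p b > 0"
    and sum1: "(\<Sum>b\<in>B. p b) = 1" and att: "is_attractor R B X"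
    and inv: "is_invariant_measure R B p \<mu>"
    and A: "A \<in> sets borel" "A \<inter> X = {}"
  shows "measure \<mu> A = 0"
proof -
  interpret prob_space \<mu> using inv by (simp add: is_invariant_measure_def)
  have sets_\<mu>: "sets \<mu> = sets borel" using inv by (simp add: is_invariant_measure_def)
  have X: "X \<noteq> {}" "closed X" using att by (auto simp: is_attractor_def compact_imp_closed)
  have "A \<subseteq> (\<Union>j. far_from X (1 / Suc j))"
  proof
    fix y assume "y \<in> A"
    then have "infdist y X > 0" using A(2) X by (intro infdist_pos_not_in_closed) auto
    then obtain j where "1 / Suc j < infdist y X" using reals_Archimedean
      by (metis inverse_eq_divide of_nat_Suc)
    then show "y \<in> (\<Union>j. far_from X (1 / Suc j))" unfolding far_from_def by (auto intro: less_imp_le)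
  qed
  moreover have "(\<Union>j. far_from X (1 / Suc j)) \<in> null_sets \<mu>"
    using measure_far_from_attractor_0[OF exp pos sum1 att inv] far_from_borel sets_\<mu>
    by (intro null_sets_UN) (simp add: null_sets_def emeasure_eq_measure)
  ultimately have "A \<in> null_sets \<mu>" using A(1) sets_\<mu> null_sets_subset by blast
  then show ?thesis by (simp add: measure_def null_setsD1)
qed

lemma compact_iterate_image:
  assumes "tau \<in> maps_level R B k" "compact X"
  shows "compact ((tau ^^ n) ` X)"
  using assms unfolding maps_level_def by (auto simp: word_map_funpow compact_image_word_map)

text \<open>Since \<open>\<tau>\<^sub>I\<^sup>n = \<tau>\<^sub>I\<^sub>\<dots>\<^sub>I\<close>, the iterates of \<open>\<tau>\<^sub>I\<close> contract at the rate \<open>K (\<rho>\<^sup>|\<^sup>I\<^sup>|)\<^sup>n\<close>.\<close>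
lemma word_map_iterate_contraction:
  assumes contr: "\<And>w x y. dist (word_map R w x) (word_map R w y) \<le> K * \<rho> ^ length w * dist x y"
  shows "dist ((word_map R w ^^ n) x) ((word_map R w ^^ n) y) \<le> K * (\<rho> ^ length w) ^ n * dist x y"
proof -
  have "\<rho> ^ length (concat (replicate n w)) = (\<rho> ^ length w) ^ n"
    by (simp add: length_concat sum_list_replicate) (metis mult.commute power_mult)
  then show ?thesis using contr[of "concat (replicate n w)" x y] by (simp add: word_map_funpow)
qed

text \<open>For a nonempty word \<open>I\<close>, the map \<open>\<tau>\<^sub>I\<close> has a unique fixed point: a sufficiently high
  iterate of \<open>\<tau>\<^sub>I\<close> is a contraction, with a fixed point in the complete set \<open>X\<close> (Banach), and
  any fixed point of \<open>\<tau>\<^sub>I\<close> is fixed by that iterate.\<close>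
lemma fixed_point_word_map:
  assumes exp: "expansive R" and att: "is_attractor R B X"
    and w: "set w \<subseteq> B" "w \<noteq> []"
  defines "tau \<equiv> word_map R w"
  shows "tau (fixed_point tau) = fixed_point tau"
proof -
  have X: "X \<noteq> {}" "compact X" using att by (auto simp: is_attractor_def)
  obtain K \<rho> where K: "0 < K" "0 < \<rho>" "\<rho> < 1"
    and contr: "\<And>w x y. dist (word_map R w x) (word_map R w y) \<le> K * \<rho> ^ length w * dist x y"
    using word_map_contraction[OF exp] by blast
  define r where "r = \<rho> ^ length w"
  have r: "0 < r" "r < 1" using K w(2) by (auto simp: r_def power_less_one_iff)
  have iter_contr: "dist ((tau ^^ n) x) ((tau ^^ n) y) \<le> K * r ^ n * dist x y" for n x y
    unfolding tau_def r_def by (rule word_map_iterate_contraction[OF contr])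
  have iter_X: "(tau ^^ n) ` X \<subseteq> X" for n
    unfolding tau_def word_map_funpow by (rule word_map_attractor[OF att]) (use w(1) in auto)
  have "(\<lambda>n. K * r ^ n) \<longlonglongrightarrow> 0"
    using r by (intro tendsto_mult_right_zero LIMSEQ_realpow_zero) auto
  from order_tendstoD(2)[OF this, of 1] obtain N where N: "K * r ^ N < 1"
    by (auto simp: eventually_sequentially)
  have "0 \<le> K * r ^ N" using K r by simp
  then have "\<exists>!x\<in>X. (tau ^^ N) x = x"
    by (intro Banach_fix[OF compact_imp_complete[OF X(2)] X(1) _ N iter_X] iter_contr)
  then obtain x0 where x0: "x0 \<in> X" "(tau ^^ N) x0 = x0"
    and unique: "\<And>y. y \<in> X \<Longrightarrow> (tau ^^ N) y = y \<Longrightarrow> y = x0"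
    by blast
  have fix0: "tau x0 = x0"
    using iter_X[of 1] x0 by (intro unique) (auto simp: funpow_swap1[symmetric])
  have "fixed_point tau = x0"
    unfolding fixed_point_def
  proof (rule the_equality)
    fix y assume "tau y = y"
    then have "(tau ^^ N) y = y" by (induction N) simp_all
    then have "dist y x0 \<le> K * r ^ N * dist y x0" using iter_contr[of N y x0] x0(2) by simp
    then have "(1 - K * r ^ N) * dist y x0 \<le> 0" by (simp add: algebra_simps)
    with N have "dist y x0 \<le> 0" by (simp add: mult_le_0_iff)
    then show "y = x0" by simp
  qed (fact fix0)
  with fix0 show ?thesis by simp
qed

text \<open>The images \<open>\<tau>\<^sub>I\<^sup>n(X)\<close> shrink uniformly to the fixed point of \<open>\<tau>\<^sub>I\<close>.\<close>
lemma iterates_converge_to_fixed_point: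
  assumes exp: "expansive R" and att: "is_attractor R B X"
    and w: "set w \<subseteq> B" "w \<noteq> []" and \<epsilon>: "\<epsilon> > 0"
  defines "tau \<equiv> word_map R w"
  shows "\<forall>\<^sub>F n in sequentially. \<forall>x\<in>X. dist ((tau ^^ n) x) (fixed_point tau) < \<epsilon>"
proof -
  define x0 where "x0 = fixed_point tau"
  have "tau x0 = x0"
    using fixed_point_word_map[OF exp att w] unfolding x0_def tau_def .
  then have fix_n: "(tau ^^ n) x0 = x0" for n by (induction n) simp_all
  obtain K \<rho> where K: "0 < K" "0 < \<rho>" "\<rho> < 1"
    and contr: "\<And>w x y. dist (word_map R w x) (word_map R w y) \<le> K * \<rho> ^ length w * dist x y"
    using word_map_contraction[OF exp] by blast
  define r where "r = \<rho> ^ length w"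
  have r: "0 < r" "r < 1" using K w(2) by (auto simp: r_def power_less_one_iff)
  obtain D where D: "\<forall>x\<in>X. dist x0 x \<le> D"
    using att unfolding is_attractor_def
    by (metis compact_imp_bounded bounded_any_center)
  have "(\<lambda>n. K * r ^ n * D) \<longlonglongrightarrow> 0"
    using r by (intro tendsto_mult_left_zero tendsto_mult_right_zero LIMSEQ_realpow_zero) auto
  then have "\<forall>\<^sub>F n in sequentially. K * r ^ n * D < \<epsilon>" using \<epsilon> by (rule order_tendstoD(2))
  then show ?thesis
  proof (rule eventually_mono, intro ballI)
    fix n x assume n: "K * r ^ n * D < \<epsilon>" and x: "x \<in> X"
    have "dist ((tau ^^ n) x) x0 = dist ((tau ^^ n) x) ((tau ^^ n) x0)"
      by (simp add: fix_n)
    also have "\<dots> \<le> K * r ^ n * dist x x0"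
      unfolding tau_def r_def by (rule word_map_iterate_contraction[OF contr])
    also have "\<dots> \<le> K * r ^ n * D" using D x K r by (intro mult_left_mono) (auto simp: dist_commute)
    finally show "dist ((tau ^^ n) x) (fixed_point tau) < \<epsilon>" using n by (simp add: x0_def)
  qed
qed

text \<open>Under the fixed point condition, the images \<open>\<tau>\<^sup>n(X)\<close> eventually avoid \<open>\<sigma>(X)\<close> for every other
  map \<open>\<sigma> \<in> \<A>\<^sub>k\<close>: they shrink to \<open>x\<^sub>\<tau>\<close>, which has positive distance from each compact \<open>\<sigma>(X)\<close>.\<close>
lemma iterate_images_eventually_disjoint:
  assumes exp: "expansive R" and fin: "finite B" and att: "is_attractor R B X"
    and tau: "tau \<in> maps_level R B k" and fpc: "fixed_point_condition R B X k tau"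
  shows "\<forall>\<^sub>F n in sequentially. \<forall>\<sigma>\<in>maps_level R B k - {tau}. \<sigma> ` X \<inter> (tau ^^ n) ` X = {}"
proof (cases "k = 0")
  case True
  then have no_other: "maps_level R B k - {tau} = {}" using tau by (auto simp: maps_level_def words_0)
  show ?thesis unfolding no_other by simp
next
  case False
  obtain w where w: "w \<in> words B k" "tau = word_map R w"
    using tau unfolding maps_level_def by auto
  then have "set w \<subseteq> B" "w \<noteq> []" using False by (auto simp: words_def)
  note shrink = iterates_converge_to_fixed_point[OF exp att \<open>set w \<subseteq> B\<close> \<open>w \<noteq> []\<close>, folded w(2)]
  have "finite (maps_level R B k - {tau})" unfolding maps_level_def using finite_words[OF fin] by simp
  then show ?thesis
  proof (intro eventually_ball_finite ballI)
    fix \<sigma> assume \<sigma>: "\<sigma> \<in> maps_level R B k - {tau}"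
    then obtain v where v: "\<sigma> = word_map R v" unfolding maps_level_def by auto
    have "compact (\<sigma> ` X)" "\<sigma> ` X \<noteq> {}"
      using att v by (simp_all add: compact_image_word_map is_attractor_def)
    moreover have "fixed_point tau \<notin> \<sigma> ` X"
      using fpc \<sigma> unfolding fixed_point_condition_def by blast
    ultimately have d: "infdist (fixed_point tau) (\<sigma> ` X) > 0"
      by (intro infdist_pos_not_in_closed compact_imp_closed)
    show "\<forall>\<^sub>F n in sequentially. \<sigma> ` X \<inter> (tau ^^ n) ` X = {}"
      using shrink[OF d]
    proof (rule eventually_mono)
      fix n
      assume close: "\<forall>x\<in>X. dist ((tau ^^ n) x) (fixed_point tau) < infdist (fixed_point tau) (\<sigma> ` X)"
      have "(tau ^^ n) x \<notin> \<sigma> ` X" if x: "x \<in> X" for x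
      proof
        assume "(tau ^^ n) x \<in> \<sigma> ` X"
        then have "infdist (fixed_point tau) (\<sigma> ` X) \<le> dist (fixed_point tau) ((tau ^^ n) x)"
          by (rule infdist_le)
        moreover have "dist ((tau ^^ n) x) (fixed_point tau) < infdist (fixed_point tau) (\<sigma> ` X)"
          using bspec[OF close x] .
        ultimately show False by (simp add: dist_commute)
      qed
      then show "\<sigma> ` X \<inter> (tau ^^ n) ` X = {}" by auto (metis imageI)
    qed
  qed
qed

text \<open>The key recurrence.  If \<open>\<tau>(Y)\<close> avoids \<open>\<sigma>(X)\<close> for all other \<open>\<sigma> \<in> \<A>\<^sub>k\<close>, then in the iterated
  invariance equation at level \<open>k\<close> for \<open>\<tau>(Y)\<close> only the words representing \<open>\<tau>\<close> contribute
  (the other preimages miss the support \<open>X\<close> of \<open>\<mu>\<close>), so \<open>\<mu>(\<tau>(Y)) = p\<^sub>\<tau> \<mu>(Y)\<close>.\<close>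
lemma measure_image_level_map:
  assumes exp: "expansive R" and fin: "finite B" and pos: "\<forall>b\<in>B. p b > 0"
    and sum1: "(\<Sum>b\<in>B. p b) = 1" and att: "is_attractor R B X"
    and inv: "is_invariant_measure R B p \<mu>" and tau: "tau \<in> maps_level R B k"
    and Y: "compact Y" and disj: "\<forall>\<sigma>\<in>maps_level R B k - {tau}. \<sigma> ` X \<inter> tau ` Y = {}"
  shows "measure \<mu> (tau ` Y) = map_weight R B p k tau * measure \<mu> Y"
proof -
  define W where "W = {w \<in> words B k. word_map R w = tau}"
  let ?term = "\<lambda>w. word_weight p w * measure \<mu> (word_map R w -` tau ` Y)"
  have A: "tau ` Y \<in> sets borel"
    using tau Y unfolding maps_level_def
    by (auto intro!: borel_closed compact_imp_closed compact_image_word_map)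
  have other: "?term w = 0" if w: "w \<in> words B k - W" for w
  proof -
    have "word_map R w \<in> maps_level R B k - {tau}" using w by (auto simp: W_def maps_level_def)
    then have "word_map R w ` X \<inter> tau ` Y = {}" using disj by blast
    then have "word_map R w -` tau ` Y \<inter> X = {}" by blast
    then show ?thesis
      by (simp add: invariant_measure_support[OF exp pos sum1 att inv] borel_vimage_word_map[OF A])
  qed
  have inj: "inj tau"
    using tau inj_word_map[OF expansive_invertible[OF exp]] unfolding maps_level_def by auto
  have "measure \<mu> (tau ` Y) = (\<Sum>w\<in>words B k. ?term w)"
    by (rule measure_words[OF inv A])
  also have "\<dots> = (\<Sum>w\<in>W. ?term w)"
    using other finite_words[OF fin] by (intro sum.mono_neutral_right) (auto simp: W_def)
  also have "\<dots> = (\<Sum>w\<in>W. word_weight p w * measure \<mu> Y)"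
    using inj by (simp add: W_def inj_vimage_image_eq)
  also have "\<dots> = map_weight R B p k tau * measure \<mu> Y"
    by (simp add: map_weight_def W_def sum_distrib_right)
  finally show ?thesis .
qed

theorem proposition3p9:
  fixes R :: "real^'n^'n" and B :: "(real^'n) set" and p :: "real^'n \<Rightarrow> real"
    and X :: "(real^'n) set" and \<mu> :: "(real^'n) measure"
    and k :: nat and tau :: "real^'n \<Rightarrow> real^'n"
  assumes "expansive R"
    and "finite B"
    and "\<forall>b\<in>B. p b > 0"
    and "(\<Sum>b\<in>B. p b) = 1"
    and "is_attractor R B X"
    and "is_invariant_measure R B p \<mu>"
    and "tau \<in> maps_level R B k"
    and "fixed_point_condition R B X k tau"
  shows "\<exists>n0 C. \<forall>n\<ge>n0. measure \<mu> ((tau ^^ n) ` X) = C * (map_weight R B p k tau) ^ n"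
proof -
  define pt where "pt = map_weight R B p k tau"
  have pt: "pt > 0" unfolding pt_def using assms(2,3,7) by (rule map_weight_pos)
  obtain n0 where disj: "\<And>n. n \<ge> n0 \<Longrightarrow>
      \<forall>\<sigma>\<in>maps_level R B k - {tau}. \<sigma> ` X \<inter> (tau ^^ n) ` X = {}"
    using iterate_images_eventually_disjoint[OF assms(1,2,5,7,8)]
    unfolding eventually_sequentially by blast
  have recurrence: "measure \<mu> ((tau ^^ Suc n) ` X) = pt * measure \<mu> ((tau ^^ n) ` X)" if "n \<ge> n0" for n
  proof -
    have "(tau ^^ Suc n) ` X = tau ` (tau ^^ n) ` X" by (simp add: image_comp)
    moreover have "compact ((tau ^^ n) ` X)"
      using assms(5,7) by (intro compact_iterate_image) (auto simp: is_attractor_def)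
    ultimately show ?thesis
      using measure_image_level_map[OF assms(1-7)] disj[of "Suc n"] that by (simp add: pt_def)
  qed
  define C where "C = measure \<mu> ((tau ^^ n0) ` X) / pt ^ n0"
  have "measure \<mu> ((tau ^^ n) ` X) = C * pt ^ n" if "n \<ge> n0" for n
    using that
  proof (induction n rule: dec_induct)
    case base
    then show ?case using pt by (simp add: C_def)
  next
    case (step m)
    then show ?case using recurrence[of m] by simp
  qed
  then show ?thesis unfolding pt_def by blast
qed

end
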